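(* Let $d\ge 1$ and let $k_1,\ldots,k_d$ be positive integers with $k_1\cdot k_2\cdots k_d>1$. Then, as $n\to\infty$, $$f(n,R^{k_1,\ldots,k_d},d)=\Omega\left(n^{d-\beta(k_1,\ldots,k_d)}\right),\qquad\text{where } \beta(k_1,\ldots,k_d)=\frac{k_1+\cdots+k_d-d}{k_1\cdot k_2\cdots k_d-1}.$$
   Context: A $d$-dimensional $n_1\times\cdots\times n_d$ zero-one matrix is an array $A=(a_{i_1,\ldots,i_d})$, $1\le i_\ell\le n_\ell$, with entries in $\{0,1\}$. A submatrix is obtained by selecting, for each $\ell$, a set of values of the $\ell$-th coordinate (keeping the order). $A$ contains a $d$-dimensional zero-one matrix $P$ if some submatrix of $A$ can be transformed into $P$ by changing any number of ones to zeros; otherwise $A$ avoids $P$. $f(n,P,d)$ denotes the maximum number of ones in a $d$-dimensional $n\times\cdots\times n$ zero-one matrix that avoids $P$. $R^{k_1,\ldots,k_d}$ denotes the $d$-dimensional $k_1\times\cdots\times k_d$ matrix of all ones. The implied constant may depend on $d,k_1,\ldots,k_d$ but not on $n$. *)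

theory Defs
  imports Complex_Main "HOL-Library.FuncSet" "HOL-Library.Landau_Symbols"
begin

text \<open>
  A \<open>d\<close>-dimensional array of size \<open>m 1 \<times> \<dots> \<times> m d\<close> is a function on index tuples. Tuples are functions
  on \<open>{1..d}\<close>; both tuples and arrays are kept \<^const>\<open>extensional\<close>, so that distinct functions are distinct
  arrays and there are only finitely many zero-one arrays of a given size.
\<close>

definition indices :: "nat \<Rightarrow> (nat \<Rightarrow> nat) \<Rightarrow> (nat \<Rightarrow> nat) set" where
  "indices d m = (\<Pi>\<^sub>E l\<in>{1..d}. {1..m l})"

definition zero_one_matrices :: "nat \<Rightarrow> (nat \<Rightarrow> nat) \<Rightarrow> ((nat \<Rightarrow> nat) \<Rightarrow> nat) set" where
  "zero_one_matrices d m = (indices d m \<rightarrow>\<^sub>E {0, 1})"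

text \<open>
  The submatrix of \<open>A\<close> on the coordinate values \<open>S 1, \<dots>, S d\<close>, of size \<open>card (S 1) \<times> \<dots> \<times> card (S d)\<close>:
  index \<open>j\<close> in direction \<open>l\<close> refers to the \<open>j\<close>-th smallest element of \<open>S l\<close> (lists count from 0).
\<close>

definition submatrix :: "nat \<Rightarrow> ((nat \<Rightarrow> nat) \<Rightarrow> nat) \<Rightarrow> (nat \<Rightarrow> nat set) \<Rightarrow> (nat \<Rightarrow> nat) \<Rightarrow> nat" where
  "submatrix d A S =
     (\<lambda>i \<in> indices d (\<lambda>l. card (S l)).
        A (\<lambda>l\<in>{1..d}. sorted_list_of_set (S l) ! (i l - 1)))"

definition ones_to_zeros ::
  "nat \<Rightarrow> (nat \<Rightarrow> nat) \<Rightarrow> ((nat \<Rightarrow> nat) \<Rightarrow> nat) \<Rightarrow> ((nat \<Rightarrow> nat) \<Rightarrow> nat) \<Rightarrow> bool" where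
  "ones_to_zeros d k B P \<longleftrightarrow> (\<forall>i\<in>indices d k. P i = B i \<or> (B i = 1 \<and> P i = 0))"

text \<open>Here \<open>A\<close> has size \<open>m 1 \<times> \<dots> \<times> m d\<close> and the pattern \<open>P\<close> has size \<open>k 1 \<times> \<dots> \<times> k d\<close>.\<close>

definition contains_pattern ::
  "nat \<Rightarrow> (nat \<Rightarrow> nat) \<Rightarrow> ((nat \<Rightarrow> nat) \<Rightarrow> nat) \<Rightarrow> (nat \<Rightarrow> nat) \<Rightarrow> ((nat \<Rightarrow> nat) \<Rightarrow> nat) \<Rightarrow> bool" where
  "contains_pattern d m A k P \<longleftrightarrow>
     (\<exists>S. (\<forall>l\<in>{1..d}. S l \<subseteq> {1..m l} \<and> card (S l) = k l) \<and>
          ones_to_zeros d k (submatrix d A S) P)"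

definition number_of_ones :: "nat \<Rightarrow> (nat \<Rightarrow> nat) \<Rightarrow> ((nat \<Rightarrow> nat) \<Rightarrow> nat) \<Rightarrow> nat" where
  "number_of_ones d m A = card {i \<in> indices d m. A i = 1}"

text \<open>
  \<open>f(n,P,d)\<close>, with the size \<open>k\<close> of \<open>P\<close> explicit. The set is finite, and it is nonempty as soon as \<open>P\<close> has a
  one, since the zero matrix then avoids \<open>P\<close>.
\<close>

definition max_ones_avoiding :: "nat \<Rightarrow> (nat \<Rightarrow> nat) \<Rightarrow> ((nat \<Rightarrow> nat) \<Rightarrow> nat) \<Rightarrow> nat \<Rightarrow> nat" where
  "max_ones_avoiding n k P d =
     Max {number_of_ones d (\<lambda>_. n) A | A.
            A \<in> zero_one_matrices d (\<lambda>_. n) \<and> \<not> contains_pattern d (\<lambda>_. n) A k P}"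

definition all_ones :: "nat \<Rightarrow> (nat \<Rightarrow> nat) \<Rightarrow> (nat \<Rightarrow> nat) \<Rightarrow> nat" where
  "all_ones d k = (\<lambda>i\<in>indices d k. 1)"

definition beta_exponent :: "nat \<Rightarrow> (nat \<Rightarrow> nat) \<Rightarrow> real" where
  "beta_exponent d k =
     ((\<Sum>l=1..d. real (k l)) - real d) / ((\<Prod>l=1..d. real (k l)) - 1)"

end

theory Submission
  imports Defs
begin

text \<open>
  Deletion method. The boxes \<open>S 1 \<times> \<dots> \<times> S d\<close> with \<open>card (S l) = k l\<close> form a hypergraph on the \<open>n ^ d\<close> cells
  with at most \<open>n ^ (k 1 + \<dots> + k d)\<close> edges, each of size \<open>K = k 1 \<cdots> k d\<close>, and a matrix avoids the all-ones
  pattern iff its ones form an independent set. Keeping each cell with probability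
  \<open>p = n powr - \<beta> / 2\<close> and then deleting one cell of each surviving edge leaves in expectation
  at least \<open>p * n ^ d - p ^ K * n ^ (k 1 + \<dots> + k d) \<ge> p * n ^ d / 2\<close> cells. The probabilistic choice is
  derandomised: the expectation is a multi-affine function of the cell probabilities,
  so each of them can be rounded to \<open>0\<close> or \<open>1\<close> without decreasing it.
\<close>

section \<open>Independent sets in uniform hypergraphs by derandomised deletion\<close>

text \<open>\<open>F x\<close> is a convex combination of its two values with coordinate
  \<open>v\<close> set to \<open>0\<close> and \<open>1\<close>, so the larger of them is at least
  \<open>F x\<close>. Coordinates are fixed one at a time; affinity is assumed at every point and
  thus survives the updates.\<close>

lemma round_multi_affine:
  fixes F :: "('a \<Rightarrow> real) \<Rightarrow> real"
  assumes "finite U"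
    and affine: "\<And>x v. v \<in> U \<Longrightarrow> F x = (1 - x v) * F (x(v := 0)) + x v * F (x(v := 1))"
    and "\<And>v. v \<in> U \<Longrightarrow> 0 \<le> x v \<and> x v \<le> 1"
  shows "\<exists>y. (\<forall>v\<in>U. y v = 0 \<or> y v = 1) \<and> (\<forall>v. v \<notin> U \<longrightarrow> y v = x v) \<and> F x \<le> F y"
  using assms
proof (induction U arbitrary: x rule: finite_induct)
  case empty
  then show ?case by auto
next
  case (insert v U)
  have v: "0 \<le> x v" "x v \<le> 1"
    using insert.prems(2)[of v] by auto
  define m where "m = max (F (x(v := 0))) (F (x(v := 1)))"
  have "F x = (1 - x v) * F (x(v := 0)) + x v * F (x(v := 1))"
    by (rule insert.prems(1)) simp
  also have "\<dots> \<le> (1 - x v) * m + x v * m"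
    using v by (intro add_mono mult_left_mono) (auto simp: m_def)
  also have "\<dots> = m" by (simp add: algebra_simps)
  finally have "F x \<le> m" .
  then obtain c where c: "c = 0 \<or> c = 1" "F x \<le> F (x(v := c))"
    unfolding m_def max_def by (metis (full_types))
  have "\<exists>y. (\<forall>u\<in>U. y u = 0 \<or> y u = 1) \<and> (\<forall>u. u \<notin> U \<longrightarrow> y u = (x(v := c)) u) \<and> F (x(v := c)) \<le> F y"
    using insert.prems insert.hyps by (intro insert.IH) auto
  then obtain y where y: "\<forall>u\<in>U. y u = 0 \<or> y u = 1"
      "\<forall>u. u \<notin> U \<longrightarrow> y u = (x(v := c)) u" "F (x(v := c)) \<le> F y"
    by blast
  have "y v = c" using y(2) insert.hyps by simp
  then show ?case
    using y c by (intro exI[of _ y]) auto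
qed

lemma prod_affine:
  fixes x :: "'a \<Rightarrow> real"
  assumes "finite e"
  shows "prod x e = (1 - x v) * prod (x(v := 0)) e + x v * prod (x(v := 1)) e"
proof (cases "v \<in> e")
  case True
  have "prod (x(v := c)) (e - {v}) = prod x (e - {v})" for c
    by (rule prod.cong) auto
  then show ?thesis
    using prod.remove[OF assms True, of x] prod.remove[OF assms True, of "x(v := c)" for c]
    by simp
next
  case False
  then have "prod (x(v := c)) e = prod x e" for c
    by (intro prod.cong) auto
  then show ?thesis by (simp add: algebra_simps)
qed

lemma sum_affine:
  fixes x :: "'a \<Rightarrow> real"
  assumes "finite V"
  shows "sum x V = (1 - x v) * sum (x(v := 0)) V + x v * sum (x(v := 1)) V"
proof (cases "v \<in> V")
  case True
  have "sum (x(v := c)) (V - {v}) = sum x (V - {v})" for c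
    by (rule sum.cong) auto
  then show ?thesis
    using sum.remove[OF assms True, of x] sum.remove[OF assms True, of "x(v := c)" for c]
    by (simp add: algebra_simps)
next
  case False
  then have "sum (x(v := c)) V = sum x V" for c
    by (intro sum.cong) auto
  then show ?thesis by (simp add: algebra_simps)
qed

text \<open>Both sides are values of one multi-affine function: the right one at the constant point
  \<open>p\<close>, the left one at the rounded point, which is the indicator of \<open>T\<close> on
  \<open>V\<close>.\<close>

lemma few_edges_inside:
  fixes p :: real
  assumes "finite V" "finite E" and E: "\<And>e. e \<in> E \<Longrightarrow> e \<subseteq> V \<and> card e = K"
    and p: "0 \<le> p" "p \<le> 1"
  shows "\<exists>T\<subseteq>V. real (card T) - real (card {e \<in> E. e \<subseteq> T}) \<ge> p * real (card V) - real (card E) * p ^ K"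
proof -
  have fin: "finite e" if "e \<in> E" for e
    using E[OF that] \<open>finite V\<close> finite_subset by blast
  \<comment> \<open>If each \<open>v\<close> is kept independently with probability
    \<open>x v\<close>, this is the expected number of kept vertices minus that of edges kept
    entirely.\<close>
  define F :: "('a \<Rightarrow> real) \<Rightarrow> real" where "F x = sum x V - (\<Sum>e\<in>E. prod x e)" for x
  have "F x = (1 - x v) * F (x(v := 0)) + x v * F (x(v := 1))" for x v
  proof -
    have "(\<Sum>e\<in>E. prod x e) =
        (\<Sum>e\<in>E. (1 - x v) * prod (x(v := 0)) e + x v * prod (x(v := 1)) e)"
      by (rule sum.cong[OF refl]) (rule prod_affine[OF fin])
    also have "\<dots> = (1 - x v) * (\<Sum>e\<in>E. prod (x(v := 0)) e) + x v * (\<Sum>e\<in>E. prod (x(v := 1)) e)"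
      by (simp only: sum.distrib sum_distrib_left)
    finally show ?thesis
      using sum_affine[OF \<open>finite V\<close>, of x v] unfolding F_def right_diff_distrib by linarith
  qed
  from round_multi_affine[OF \<open>finite V\<close>, of F "\<lambda>_. p", OF this]
  obtain y where y: "\<forall>v\<in>V. y v = 0 \<or> y v = 1" and Fy: "F (\<lambda>_. p) \<le> F y"
    using p by auto
  define T where "T = {v \<in> V. y v = 1}"
  have "sum y V = (\<Sum>v\<in>V. if v \<in> T then 1 else 0)"
    using y by (intro sum.cong) (auto simp: T_def)
  also have "\<dots> = real (card T)"
    using \<open>finite V\<close> by (simp flip: sum.inter_filter) (simp add: T_def)
  finally have sumT: "sum y V = real (card T)" .
  have "prod y e = (if e \<subseteq> T then 1 else 0)" if "e \<in> E" for e
  proof (cases "e \<subseteq> T")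
    case True
    then show ?thesis by (auto simp: T_def intro!: prod.neutral)
  next
    case False
    then obtain v where "v \<in> e" "y v = 0"
      using y E[OF \<open>e \<in> E\<close>] by (auto simp: T_def)
    then show ?thesis using False fin[OF \<open>e \<in> E\<close>] by (auto intro!: prod_zero)
  qed
  then have "(\<Sum>e\<in>E. prod y e) = real (card {e \<in> E. e \<subseteq> T})"
    using \<open>finite E\<close> by (simp flip: sum.inter_filter)
  moreover have "F (\<lambda>_. p) = p * real (card V) - real (card E) * p ^ K"
    using E by (simp add: F_def mult.commute)
  moreover have "T \<subseteq> V" by (auto simp: T_def)
  ultimately show ?thesis
    using Fy sumT by (intro exI[of _ T]) (simp add: F_def[of y])
qed

lemma independent_set_exists:
  fixes p :: real
  assumes "finite V" "finite E" and E: "\<And>e. e \<in> E \<Longrightarrow> e \<subseteq> V \<and> card e = K"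
    and "0 \<le> p" "p \<le> 1" "K > 0"
  shows "\<exists>T\<subseteq>V. (\<forall>e\<in>E. \<not> e \<subseteq> T) \<and> real (card T) \<ge> p * real (card V) - real (card E) * p ^ K"
proof -
  obtain T where "T \<subseteq> V"
    and T: "real (card T) - real (card {e \<in> E. e \<subseteq> T}) \<ge> p * real (card V) - real (card E) * p ^ K"
    using few_edges_inside[of V E K p] assms by blast
  have "\<forall>e\<in>E. \<exists>v. v \<in> e"
    using E \<open>K > 0\<close> by (metis card.empty ex_in_conv less_irrefl)
  then obtain g where g: "\<And>e. e \<in> E \<Longrightarrow> g e \<in> e"
    by metis
  \<comment> \<open>One vertex from each edge inside \<open>T\<close>. An edge inside
    \<open>T - D\<close> would lie inside \<open>T\<close>, so its chosen vertex would have been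
    deleted.\<close>
  define D where "D = g ` {e \<in> E. e \<subseteq> T}"
  have "card D \<le> card {e \<in> E. e \<subseteq> T}"
    using \<open>finite E\<close> by (auto simp: D_def intro: card_image_le)
  moreover have "card T - card D \<le> card (T - D)"
    using \<open>finite E\<close> by (intro diff_card_le_card_Diff) (simp add: D_def)
  ultimately have "real (card (T - D)) \<ge> p * real (card V) - real (card E) * p ^ K"
    using T by linarith
  moreover have "\<not> e \<subseteq> T - D" if "e \<in> E" for e
    using g[OF that] that by (auto simp: D_def)
  ultimately show ?thesis
    using \<open>T \<subseteq> V\<close> by (intro exI[of _ "T - D"]) blast
qed

section \<open>Boxes of cells as edges, matrices as vertex sets\<close>

text \<open>A zero can never become a one, so the submatrix itself must be all ones; its cells, read
  in the coordinates of \<open>A\<close>, form the box.\<close>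

lemma box_of_ones_if_contains:
  assumes "contains_pattern d m A k (all_ones d k)"
  obtains S where "S \<in> (\<Pi>\<^sub>E l\<in>{1..d}. {B. B \<subseteq> {1..m l} \<and> card B = k l})"
    "\<And>j. j \<in> Pi\<^sub>E {1..d} S \<Longrightarrow> A j = 1"
proof -
  obtain S0 where S0: "\<And>l. l \<in> {1..d} \<Longrightarrow> S0 l \<subseteq> {1..m l} \<and> card (S0 l) = k l"
    and conv: "ones_to_zeros d k (submatrix d A S0) (all_ones d k)"
    using assms unfolding contains_pattern_def by blast
  have idx: "indices d (\<lambda>l. card (S0 l)) = indices d k"
    unfolding indices_def using S0 by (intro PiE_cong) auto
  have "A j = 1" if j: "j \<in> Pi\<^sub>E {1..d} S0" for j
  proof -
    have "\<exists>t. t < k l \<and> sorted_list_of_set (S0 l) ! t = j l" if "l \<in> {1..d}" for l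
    proof -
      have "finite (S0 l)" using S0[OF that] finite_subset by blast
      then have "j l \<in> set (sorted_list_of_set (S0 l))" using j that by auto
      then show ?thesis
        using S0[OF that] by (auto simp: in_set_conv_nth)
    qed
    then obtain t where t: "\<And>l. l \<in> {1..d} \<Longrightarrow> t l < k l \<and> sorted_list_of_set (S0 l) ! t l = j l"
      by metis
    \<comment> \<open>\<open>t l\<close> is a list position counted from 0, matrix indices count
      from 1.\<close>
    define i where "i = (\<lambda>l\<in>{1..d}. Suc (t l))"
    have i: "i \<in> indices d k"
      using t by (auto simp: i_def indices_def Suc_le_eq)
    have "(\<lambda>l\<in>{1..d}. sorted_list_of_set (S0 l) ! (i l - 1)) = j"
      using j t by (intro extensionalityI[of _ "{1..d}"]) (auto simp: i_def PiE_def)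
    then have "submatrix d A S0 i = A j"
      using i by (simp add: submatrix_def idx)
    moreover have "submatrix d A S0 i = 1"
      using conv i by (auto simp: ones_to_zeros_def all_ones_def)
    ultimately show ?thesis by simp
  qed
  \<comment> \<open>\<open>S0\<close> is arbitrary outside \<open>{1..d}\<close>; restriction makes
    it extensional and leaves the box unchanged.\<close>
  moreover have "Pi\<^sub>E {1..d} (restrict S0 {1..d}) = Pi\<^sub>E {1..d} S0"
    by (intro PiE_cong) auto
  ultimately show ?thesis
    using S0 by (intro that[of "restrict S0 {1..d}"]) auto
qed

lemma finite_zero_one_matrices: "finite (zero_one_matrices d m)"
  unfolding zero_one_matrices_def indices_def by (intro finite_PiE) auto

lemma number_of_ones_le_max_ones_avoiding:
  assumes "A \<in> zero_one_matrices d (\<lambda>_. n)" "\<not> contains_pattern d (\<lambda>_. n) A k P"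
  shows "number_of_ones d (\<lambda>_. n) A \<le> max_ones_avoiding n k P d"
  unfolding max_ones_avoiding_def
proof (rule Max_ge)
  show "finite {number_of_ones d (\<lambda>_. n) A | A.
      A \<in> zero_one_matrices d (\<lambda>_. n) \<and> \<not> contains_pattern d (\<lambda>_. n) A k P}"
    by (rule finite_subset[of _ "number_of_ones d (\<lambda>_. n) ` zero_one_matrices d (\<lambda>_. n)"])
      (auto intro: finite_zero_one_matrices)
qed (use assms in auto)

text \<open>There are \<open>n choose k l\<close> choices in direction \<open>l\<close>. Bounding
  this by \<open>n ^ k l\<close> costs, for large \<open>n\<close>, only a factor depending on
  \<open>k\<close>.\<close>

lemma card_boxes_le:
  fixes d :: nat
  shows "card ((\<lambda>S. Pi\<^sub>E {1..d} S) ` (\<Pi>\<^sub>E l\<in>{1..d}. {B. B \<subseteq> {1..n} \<and> card B = k l})) \<le> n ^ (\<Sum>l=1..d. k l)"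
proof -
  have "card ((\<lambda>S. Pi\<^sub>E {1..d} S) ` (\<Pi>\<^sub>E l\<in>{1..d}. {B. B \<subseteq> {1..n} \<and> card B = k l}))
      \<le> card (\<Pi>\<^sub>E l\<in>{1..d}. {B. B \<subseteq> {1..n} \<and> card B = k l})"
    by (intro card_image_le finite_PiE) auto
  also have "\<dots> = (\<Prod>l=1..d. n choose k l)"
    by (simp add: card_PiE n_subsets)
  also have "\<dots> \<le> (\<Prod>l=1..d. n ^ k l)"
  proof (intro prod_mono conjI)
    show "n choose k l \<le> n ^ k l" for l
      by (cases "k l \<le> n") (auto simp: binomial_le_pow binomial_eq_0)
  qed auto
  finally show ?thesis by (simp add: power_sum)
qed

text \<open>An independent set of cells gives an avoiding matrix, its indicator. The density
  \<open>p\<close> stays free here, to be balanced against \<open>n\<close> afterwards.\<close>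

lemma max_ones_avoiding_all_ones_ge:
  fixes p :: real
  assumes "0 \<le> p" "p \<le> 1" "(\<Prod>l=1..d. k l) > 0"
  shows "p * real n ^ d - real n ^ (\<Sum>l=1..d. k l) * p ^ (\<Prod>l=1..d. k l)
    \<le> real (max_ones_avoiding n k (all_ones d k) d)"
proof -
  define V where "V = indices d (\<lambda>_. n)"
  define C where "C = (\<Pi>\<^sub>E l\<in>{1..d}. {B. B \<subseteq> {1..n} \<and> card B = k l})"
  define E where "E = (\<lambda>S. Pi\<^sub>E {1..d} S) ` C"
  define K where "K = (\<Prod>l=1..d. k l)"
  have finV: "finite V"
    unfolding V_def indices_def by (intro finite_PiE) auto
  have finE: "finite E"
    unfolding E_def C_def by (intro finite_imageI finite_PiE) auto
  have E: "e \<subseteq> V \<and> card e = K" if "e \<in> E" for e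
  proof -
    obtain S where S: "S \<in> C" "e = Pi\<^sub>E {1..d} S"
      using \<open>e \<in> E\<close> by (auto simp: E_def)
    have Sl: "S l \<subseteq> {1..n}" "card (S l) = k l" if "l \<in> {1..d}" for l
      using S(1) that by (auto simp: C_def dest!: PiE_mem)
    have "e \<subseteq> V"
      unfolding S(2) V_def indices_def using Sl by (intro PiE_mono) auto
    then show ?thesis
      using Sl by (simp add: S(2) card_PiE K_def)
  qed
  obtain T where TV: "T \<subseteq> V" and indep: "\<And>e. e \<in> E \<Longrightarrow> \<not> e \<subseteq> T"
    and cardT: "real (card T) \<ge> p * real (card V) - real (card E) * p ^ K"
    using independent_set_exists[OF finV finE E, of p] assms by (auto simp: K_def)
  define A where "A = (\<lambda>i\<in>V. if i \<in> T then 1 else 0 :: nat)"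
  have "A \<in> zero_one_matrices d (\<lambda>_. n)"
    by (auto simp: A_def V_def zero_one_matrices_def)
  moreover have "\<not> contains_pattern d (\<lambda>_. n) A k (all_ones d k)"
  proof
    assume "contains_pattern d (\<lambda>_. n) A k (all_ones d k)"
    then obtain S where S: "S \<in> C" "\<And>j. j \<in> Pi\<^sub>E {1..d} S \<Longrightarrow> A j = 1"
      unfolding C_def by (elim box_of_ones_if_contains) blast
    have e: "Pi\<^sub>E {1..d} S \<in> E" using S(1) by (simp add: E_def)
    have "Pi\<^sub>E {1..d} S \<subseteq> T"
    proof
      fix j assume j: "j \<in> Pi\<^sub>E {1..d} S"
      then have "j \<in> V" using E[OF e] by blast
      then show "j \<in> T" using S(2)[OF j] by (simp add: A_def split: if_splits)
    qed
    then show False using indep[OF e] by blast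
  qed
  ultimately have "number_of_ones d (\<lambda>_. n) A \<le> max_ones_avoiding n k (all_ones d k) d"
    by (rule number_of_ones_le_max_ones_avoiding)
  moreover have "{i \<in> V. A i = 1} = T"
    using TV by (auto simp: A_def split: if_splits)
  ultimately have "card T \<le> max_ones_avoiding n k (all_ones d k) d"
    by (simp add: number_of_ones_def V_def)
  moreover have "real (card E) * p ^ K \<le> real n ^ (\<Sum>l=1..d. k l) * p ^ K"
    using card_boxes_le[of d n k] \<open>0 \<le> p\<close>
    by (intro mult_right_mono) (simp_all add: E_def C_def flip: of_nat_power)
  moreover have "card V = n ^ d"
    by (simp add: V_def indices_def card_PiE)
  ultimately show ?thesis
    using cardT by (simp add: K_def)
qed

section \<open>Choice of the density and the resulting growth rate\<close>

theorem theorem2p1: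
  fixes d :: nat and k :: "nat \<Rightarrow> nat"
  assumes "d \<ge> 1"
    and "\<And>l. l \<in> {1..d} \<Longrightarrow> k l \<ge> 1"
    and "(\<Prod>l=1..d. k l) > 1"
  shows "(\<lambda>n. real (max_ones_avoiding n k (all_ones d k) d))
           \<in> \<Omega>(\<lambda>n. real n powr (real d - beta_exponent d k))"
proof -
  define K where "K = (\<Prod>l=1..d. k l)"
  define s where "s = (\<Sum>l=1..d. k l)"
  define b where "b = beta_exponent d k"
  have K: "K > 1" using assms(3) by (simp add: K_def)
  \<comment> \<open>\<open>d \<le> s\<close> makes the exponent \<open>b\<close> nonnegative, which
    later gives \<open>p \<le> 1\<close>.\<close>
  have "d = (\<Sum>l=1..d. 1)" by simp
  also have "\<dots> \<le> s" unfolding s_def using assms(2) by (intro sum_mono) auto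
  finally have ds: "d \<le> s" .
  have b: "b = (real s - real d) / (real K - 1)"
    by (simp add: b_def beta_exponent_def s_def K_def)
  have b0: "b \<ge> 0" using ds K by (simp add: b)
  have bK: "b * real (K - 1) = real s - real d"
    using K by (simp add: b of_nat_diff)
  \<comment> \<open>One factor \<open>1/2\<close> of the constant comes from \<open>p\<close>, the
    other from the deleted cells.\<close>
  have "real n powr (real d - b) / 4 \<le> real (max_ones_avoiding n k (all_ones d k) d)"
    if "n \<ge> 1" for n
  proof -
    \<comment> \<open>By \<open>bK\<close>, the power \<open>n powr - b\<close> gives
      \<open>p * n ^ d\<close> and \<open>p ^ K * n ^ s\<close> the same order in \<open>n\<close>.
      The factor \<open>1/2\<close> in \<open>p\<close> makes the latter at most half of the former,
      because \<open>K - 1 \<ge> 1\<close>.\<close>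
    define p where "p = real n powr - b / 2"
    have p0: "p \<ge> 0" by (simp add: p_def)
    have "real n powr - b \<le> real n powr 0"
      using b0 that by (intro powr_mono) auto
    then have p1: "p \<le> 1" using that by (simp add: p_def)
    have "p ^ (K - 1) = real n powr (real d - real s) / 2 ^ (K - 1)"
      using that bK by (simp add: p_def power_divide powr_power mult.commute)
    then have "p ^ (K - 1) * real n ^ s = real n powr (real d - real s) * real n powr real s / 2 ^ (K - 1)"
      using that by (simp add: powr_realpow)
    also have "\<dots> = real n ^ d / 2 ^ (K - 1)"
      using that by (simp flip: powr_realpow powr_add)
    also have "\<dots> \<le> real n ^ d / 2"
    proof -
      have "(2::real) ^ 1 \<le> 2 ^ (K - 1)" using K by (intro power_increasing) auto
      then show ?thesis by (intro divide_left_mono) auto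
    qed
    finally have "p * (p ^ (K - 1) * real n ^ s) \<le> p * (real n ^ d / 2)"
      using p0 by (rule mult_left_mono)
    moreover have "p ^ K = p * p ^ (K - 1)"
      using K by (simp flip: power_Suc)
    ultimately have "real n ^ s * p ^ K \<le> p * real n ^ d / 2"
      by (simp add: mult_ac)
    moreover have "p * real n ^ d = real n powr (real d - b) / 2"
      using that by (simp add: p_def powr_realpow powr_diff powr_minus field_simps)
    moreover have "p * real n ^ d - real n ^ s * p ^ K \<le> real (max_ones_avoiding n k (all_ones d k) d)"
      unfolding K_def s_def using K by (intro max_ones_avoiding_all_ones_ge p0 p1) (simp only: K_def)
    ultimately show ?thesis by linarith
  qed
  then show ?thesis
    unfolding b_def
    by (intro landau_omega.bigI[of "1/4"] eventually_sequentiallyI[of 1]) auto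
qed

end
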